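(* Let $k,L\ge1$ be integers with $L\le\frac{2^k}{ek}$. Suppose that $\Phi$ is a CNF formula in which every clause contains at least $k$ distinct literals and each variable occurs in at most $L$ clauses. Then every non-trivial implicate of $\Phi$ has size at least $k-\lfloor\log_2(eL)\rfloor$, and moreover $k-\lfloor\log_2(eL)\rfloor\ge\log_2k$.
   Context: A clause is a disjunction of literals (a literal is a boolean variable or its negation); its size is its number of distinct literals. For a boolean formula $\Phi$, a clause $C$ is a non-trivial implicate of $\Phi$ if $\Phi\models C$ (every assignment satisfying $\Phi$ satisfies $C$) but $C$ is not a tautology. Here $e$ is the base of the natural logarithm. *)

theory Defs
  imports Complex_Main
begin

datatype 'v literal = Pos 'v | Neg 'v

text \<open>A clause is the set of its distinct literals and a CNF formula is the set of its clauses;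
  both are meant to be finite, which the predicates below make explicit. A clause may contain
  a literal together with its negation.\<close>

type_synonym 'v clause = "'v literal set"
type_synonym 'v cnf = "'v clause set"
type_synonym 'v assignment = "'v \<Rightarrow> bool"

definition is_clause :: "'v clause \<Rightarrow> bool" where
  "is_clause C \<longleftrightarrow> finite C"

definition is_cnf :: "'v cnf \<Rightarrow> bool" where
  "is_cnf \<Phi> \<longleftrightarrow> finite \<Phi> \<and> (\<forall>C\<in>\<Phi>. is_clause C)"

definition clause_size :: "'v clause \<Rightarrow> nat" where
  "clause_size C = card C"

fun sat_literal :: "'v assignment \<Rightarrow> 'v literal \<Rightarrow> bool" where
  "sat_literal \<sigma> (Pos x) = \<sigma> x"
| "sat_literal \<sigma> (Neg x) = (\<not> \<sigma> x)"

definition sat_clause :: "'v assignment \<Rightarrow> 'v clause \<Rightarrow> bool" where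
  "sat_clause \<sigma> C \<longleftrightarrow> (\<exists>l\<in>C. sat_literal \<sigma> l)"

definition sat_cnf :: "'v assignment \<Rightarrow> 'v cnf \<Rightarrow> bool" where
  "sat_cnf \<sigma> \<Phi> \<longleftrightarrow> (\<forall>C\<in>\<Phi>. sat_clause \<sigma> C)"

definition entails :: "'v cnf \<Rightarrow> 'v clause \<Rightarrow> bool" where
  "entails \<Phi> C \<longleftrightarrow> (\<forall>\<sigma>. sat_cnf \<sigma> \<Phi> \<longrightarrow> sat_clause \<sigma> C)"

definition tautology :: "'v clause \<Rightarrow> bool" where
  "tautology C \<longleftrightarrow> (\<forall>\<sigma>. sat_clause \<sigma> C)"

definition nontrivial_implicate :: "'v cnf \<Rightarrow> 'v clause \<Rightarrow> bool" where
  "nontrivial_implicate \<Phi> C \<longleftrightarrow> is_clause C \<and> entails \<Phi> C \<and> \<not> tautology C"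

definition occurs_in :: "'v \<Rightarrow> 'v clause \<Rightarrow> bool" where
  "occurs_in x C \<longleftrightarrow> Pos x \<in> C \<or> Neg x \<in> C"

end

theory Submission
  imports Defs
begin

text \<open>Discarding tautological clauses and shrinking the others, we may assume that every clause has
  exactly \<open>k\<close> literals. Let \<open>C\<close> be a non-tautological clause of size \<open>s < k - \<lfloor>log\<^sub>2 (e L)\<rfloor>\<close>, so that
  \<open>e L < 2 ^ (k - s)\<close>, and take a uniformly random assignment falsifying \<open>C\<close> and satisfying
  the clauses that share no variable with \<open>C\<close>; these are independent of \<open>C\<close>, and the local lemma
  shows that such assignments exist. The local lemma also shows that conditioning on these clauses
  increases the probability of falsifying another clause \<open>D\<close> by a factor of at most \<open>e\<close>, to at most
  \<open>e * 2 ^ (t - k)\<close> where \<open>t = card (C \<inter> D)\<close>. Only clauses with \<open>t > 0\<close> matter, as the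
  others that meet the variables of \<open>C\<close> contain the complement of a literal of \<open>C\<close>. The bound
  \<open>2 ^ t \<le> (t / s) * 2 ^ s\<close> and double counting of the occurrences of the literals of \<open>C\<close> make
  these probabilities sum to at most \<open>e * L * 2 ^ (s - k) < 1\<close>. So some assignment satisfies all
  clauses and falsifies \<open>C\<close>.\<close>

section \<open>Clauses and independent variables\<close>

fun literal_var :: "'v literal \<Rightarrow> 'v" where
  "literal_var (Pos x) = x"
| "literal_var (Neg x) = x"

lemma occurs_in_iff: "occurs_in x C \<longleftrightarrow> x \<in> literal_var ` C"
proof
  assume "occurs_in x C"
  then show "x \<in> literal_var ` C"
    unfolding occurs_in_def by force
next
  assume "x \<in> literal_var ` C"
  then obtain l where "l \<in> C" "x = literal_var l" by auto
  then show "occurs_in x C"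
    unfolding occurs_in_def by (cases l) auto
qed

lemma tautology_iff: "tautology C \<longleftrightarrow> (\<exists>x. Pos x \<in> C \<and> Neg x \<in> C)"
proof
  assume "tautology C"
  \<comment> \<open>This assignment makes a literal of \<open>C\<close> true only if its complement
    lies in \<open>C\<close> as well.\<close>
  then have "sat_clause (\<lambda>x. Neg x \<in> C) C"
    by (simp add: tautology_def)
  then obtain l where "l \<in> C" "sat_literal (\<lambda>x. Neg x \<in> C) l"
    by (auto simp: sat_clause_def)
  then show "\<exists>x. Pos x \<in> C \<and> Neg x \<in> C"
    by (cases l) auto
next
  assume "\<exists>x. Pos x \<in> C \<and> Neg x \<in> C"
  then obtain x where x: "Pos x \<in> C" "Neg x \<in> C" by auto
  show "tautology C"
    unfolding tautology_def sat_clause_def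
  proof
    fix \<sigma>
    show "\<exists>l\<in>C. sat_literal \<sigma> l"
      using x by (cases "\<sigma> x") (auto intro: bexI[of _ "Pos x"] bexI[of _ "Neg x"])
  qed
qed

lemma tautology_mono: "tautology C \<Longrightarrow> C \<subseteq> D \<Longrightarrow> tautology D"
  by (auto simp: tautology_iff)

lemma sat_clause_Un: "sat_clause \<sigma> (C \<union> D) \<longleftrightarrow> sat_clause \<sigma> C \<or> sat_clause \<sigma> D"
  by (auto simp: sat_clause_def)

lemma sat_literal_flip:
  "sat_literal (\<sigma>(x := \<not> \<sigma> x)) l = (if literal_var l = x then \<not> sat_literal \<sigma> l else sat_literal \<sigma> l)"
  by (cases l) auto

lemma sat_clause_flip:
  assumes "x \<notin> literal_var ` C"
  shows "sat_clause (\<sigma>(x := \<not> \<sigma> x)) C = sat_clause \<sigma> C"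
  using assms unfolding sat_clause_def by (auto simp: sat_literal_flip)

section \<open>Counting assignments and independence\<close>

text \<open>Assignments are false outside \<open>V\<close>, so that there are only finitely many of them.\<close>

definition models :: "'v set \<Rightarrow> 'v cnf \<Rightarrow> 'v clause \<Rightarrow> 'v assignment set" where
  "models V \<Gamma> E = {\<sigma>. {x. \<sigma> x} \<subseteq> V \<and> sat_cnf \<sigma> \<Gamma> \<and> \<not> sat_clause \<sigma> E}"

lemma finite_models: "finite V \<Longrightarrow> finite (models V \<Gamma> E)"
proof -
  assume "finite V"
  moreover have "inj_on Collect (models V \<Gamma> E)"
    by (auto simp: inj_on_def)
  moreover have "Collect ` models V \<Gamma> E \<subseteq> Pow V"
    by (auto simp: models_def)
  ultimately show ?thesis
    by (meson finite_Pow_iff inj_on_finite)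
qed

lemma models_antimono: "\<Gamma> \<subseteq> \<Delta> \<Longrightarrow> models V \<Delta> E \<subseteq> models V \<Gamma> E"
  by (auto simp: models_def sat_cnf_def)

text \<open>Flipping the variable of \<open>l\<close> is an involution on
  \<open>models V \<Gamma> E\<close> that exchanges the assignments satisfying \<open>l\<close> with
  those falsifying it, so each kind is exactly half.\<close>

lemma card_models_insert_literal:
  assumes V: "finite V" "literal_var l \<in> V"
    and new: "literal_var l \<notin> literal_var ` E" "\<forall>D\<in>\<Gamma>. literal_var l \<notin> literal_var ` D"
  shows "2 * card (models V \<Gamma> (insert l E)) = card (models V \<Gamma> E)"
proof -
  define x where "x = literal_var l"
  define flip :: "'a assignment \<Rightarrow> 'a assignment" where "flip \<sigma> = \<sigma>(x := \<not> \<sigma> x)" for \<sigma>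
  let ?A = "models V \<Gamma> (insert l E)" and ?M = "models V \<Gamma> E"
  have flip2: "flip (flip \<sigma>) = \<sigma>" for \<sigma>
    by (auto simp: flip_def)
  have flip_M: "flip \<sigma> \<in> ?M" if "\<sigma> \<in> ?M" for \<sigma>
    using that V new
    by (auto simp: models_def flip_def sat_cnf_def sat_clause_flip x_def split: if_splits)
  have A: "\<sigma> \<in> ?A \<longleftrightarrow> \<sigma> \<in> ?M \<and> \<not> sat_literal \<sigma> l" for \<sigma>
    by (auto simp: models_def sat_clause_def)
  have lit: "sat_literal (flip \<sigma>) l \<longleftrightarrow> \<not> sat_literal \<sigma> l" for \<sigma>
    by (simp add: flip_def sat_literal_flip x_def)
  have "?M = ?A \<union> flip ` ?A"
  proof (intro set_eqI iffI)
    fix \<sigma> assume \<sigma>: "\<sigma> \<in> ?M"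
    show "\<sigma> \<in> ?A \<union> flip ` ?A"
    proof (cases "sat_literal \<sigma> l")
      case True
      then have "flip \<sigma> \<in> ?A" using \<sigma> flip_M by (auto simp: A lit)
      then show ?thesis by (metis UnCI flip2 image_eqI)
    qed (use \<sigma> A in auto)
  qed (use A flip_M in auto)
  moreover have "?A \<inter> flip ` ?A = {}"
    using A lit by auto
  moreover have "card (flip ` ?A) = card ?A"
    by (rule card_image) (metis flip2 inj_onI)
  ultimately show ?thesis
    using finite_models[OF V(1), of \<Gamma> "insert l E"] by (simp add: card_Un_disjoint)
qed

text \<open>Independence in counting form: a uniformly random model of \<open>\<Gamma>\<close>
  falsifies \<open>E\<close> with probability \<open>1 / 2 ^ card E\<close>, since each new literal
  halves the count.\<close>

lemma card_models_independent:
  assumes "finite V" "finite E" "literal_var ` E \<subseteq> V" "\<not> tautology E"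
    and "\<forall>D\<in>\<Gamma>. literal_var ` E \<inter> literal_var ` D = {}"
  shows "2 ^ card E * card (models V \<Gamma> E) = card (models V \<Gamma> {})"
  using assms(2,3,4,5)
proof (induction E)
  case (insert l E)
  \<comment> \<open>Two distinct literals on one variable are complementary, which would make the
    clause a tautology.\<close>
  have "literal_var l \<notin> literal_var ` E"
  proof
    assume "literal_var l \<in> literal_var ` E"
    then obtain m where m: "m \<in> E" "literal_var l = literal_var m" by auto
    then have "l \<noteq> m" using insert by auto
    with m insert.prems(2) show False
      by (cases l; cases m) (auto simp: tautology_iff)
  qed
  then have "2 * card (models V \<Gamma> (insert l E)) = card (models V \<Gamma> E)"
    using insert.prems assms(1) by (intro card_models_insert_literal) auto
  moreover have "2 ^ card E * card (models V \<Gamma> E) = card (models V \<Gamma> {})"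
    using insert.prems tautology_mono[of E "insert l E"] by (intro insert.IH) auto
  ultimately show ?case
    using insert.hyps by (metis card_insert_disjoint mult.assoc power_Suc2)
qed simp

lemma card_models_insert_clause:
  assumes "finite V"
  shows "card (models V (insert D \<Gamma>) {}) + card (models V \<Gamma> D) = card (models V \<Gamma> {})"
proof -
  have "models V \<Gamma> {} = models V (insert D \<Gamma>) {} \<union> models V \<Gamma> D"
    by (auto simp: models_def sat_cnf_def sat_clause_def)
  moreover have "models V (insert D \<Gamma>) {} \<inter> models V \<Gamma> D = {}"
    by (auto simp: models_def sat_cnf_def)
  ultimately show ?thesis
    using assms by (simp add: card_Un_disjoint finite_models)
qed

text \<open>Union bound over the at most \<open>card D\<close> variables of \<open>D\<close>; the
  factor is \<open>L - 1\<close> because \<open>D\<close> itself is one of the at most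
  \<open>L\<close> clauses containing each of them.\<close>

lemma card_neighbours_le:
  assumes "finite \<Psi>" "finite D" "D \<in> \<Psi>" "\<forall>x. card {C\<in>\<Psi>. occurs_in x C} \<le> L"
  shows "card {C \<in> \<Psi> - {D}. literal_var ` D \<inter> literal_var ` C \<noteq> {}} \<le> card D * (L - 1)"
proof -
  have "card {C \<in> \<Psi> - {D}. literal_var ` D \<inter> literal_var ` C \<noteq> {}}
      \<le> card (\<Union>x\<in>literal_var ` D. {C\<in>\<Psi>. occurs_in x C} - {D})"
    using assms by (intro card_mono) (auto simp: occurs_in_iff)
  also have "\<dots> \<le> (\<Sum>x\<in>literal_var ` D. card ({C\<in>\<Psi>. occurs_in x C} - {D}))"
    using assms by (intro card_UN_le) auto
  also have "\<dots> \<le> (\<Sum>x\<in>literal_var ` D. L - 1)"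
    using assms by (intro sum_mono) (auto simp: occurs_in_iff intro!: diff_le_mono)
  also have "\<dots> \<le> card D * (L - 1)"
    using assms by (simp add: card_image_le)
  finally show ?thesis .
qed

section \<open>The local lemma\<close>

text \<open>Setting of the symmetric local lemma with weight \<open>1 - q\<close> for every clause:
  falsifying a clause has probability \<open>1 / 2 ^ k\<close>, and each clause shares variables
  with at most \<open>k * (L - 1)\<close> others. Here \<open>q\<close> bounds from below the
  conditional probability that one more clause is satisfied.\<close>

locale local_lemma =
  fixes V :: "'v set" and \<Psi> :: "'v cnf" and k L :: nat and q :: real
  assumes finite_V: "finite V" and finite_\<Psi>: "finite \<Psi>"
    and clause: "D \<in> \<Psi> \<Longrightarrow> finite D \<and> card D = k \<and> \<not> tautology D \<and> literal_var ` D \<subseteq> V"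
    and occurrences: "\<forall>x. card {C\<in>\<Psi>. occurs_in x C} \<le> L"
    and q: "0 < q" "q < 1" "1 \<le> 2 ^ k * (1 - q) * q ^ (k * (L - 1))"
begin

abbreviation number :: "'v cnf \<Rightarrow> 'v clause \<Rightarrow> real" where
  "number \<Gamma> E \<equiv> real (card (models V \<Gamma> E))"

lemma number_mono: "\<Gamma> \<subseteq> \<Delta> \<Longrightarrow> number \<Delta> E \<le> number \<Gamma> E"
  using finite_V by (simp add: card_mono finite_models models_antimono)

lemma number_independent:
  assumes "finite E" "literal_var ` E \<subseteq> V" "\<not> tautology E"
    and "\<forall>D\<in>\<Gamma>. literal_var ` E \<inter> literal_var ` D = {}"
  shows "2 ^ card E * number \<Gamma> E = number \<Gamma> {}"
proof -
  have "real (2 ^ card E * card (models V \<Gamma> E)) = number \<Gamma> {}"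
    using card_models_independent[OF finite_V] assms by metis
  then show ?thesis by simp
qed

text \<open>The clauses of \<open>\<Delta>\<close> are added one at a time, each keeping at least a
  fraction \<open>q\<close> of the assignments. The last premise speaks of proper subsets only, so
  that an induction hypothesis can supply it.\<close>

lemma number_extend_step:
  assumes "finite \<Delta>" "\<Delta> \<inter> \<Gamma> = {}"
    and "\<And>\<Gamma>' D. \<lbrakk>\<Gamma>' \<subset> \<Gamma> \<union> \<Delta>; D \<notin> \<Gamma>'; D \<in> \<Gamma> \<union> \<Delta>\<rbrakk>
      \<Longrightarrow> number \<Gamma>' D \<le> (1 - q) * number \<Gamma>' {}"
  shows "q ^ card \<Delta> * number \<Gamma> {} \<le> number (\<Gamma> \<union> \<Delta>) {}"
  using assms
proof (induction \<Delta>)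
  case (insert D \<Delta>)
  have D: "D \<notin> \<Gamma> \<union> \<Delta>"
    using insert by auto
  have "q ^ card \<Delta> * number \<Gamma> {} \<le> number (\<Gamma> \<union> \<Delta>) {}"
    using insert.prems D by (intro insert.IH) (auto 4 4)
  then have "q * (q ^ card \<Delta> * number \<Gamma> {}) \<le> q * number (\<Gamma> \<union> \<Delta>) {}"
    using q by (intro mult_left_mono) auto
  also have "\<dots> \<le> number (\<Gamma> \<union> \<Delta>) {} - number (\<Gamma> \<union> \<Delta>) D"
    using insert.prems(2)[of "\<Gamma> \<union> \<Delta>" D] D by (auto simp: algebra_simps)
  also have "\<dots> = number (\<Gamma> \<union> insert D \<Delta>) {}"
    using card_models_insert_clause[OF finite_V, of D "\<Gamma> \<union> \<Delta>"] by simp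
  finally show ?case
    using insert.hyps by simp
qed simp

lemma card_neighbours:
  assumes "D \<in> \<Psi>" "\<Gamma> \<subseteq> \<Psi>" "D \<notin> \<Gamma>"
  shows "card {C\<in>\<Gamma>. literal_var ` D \<inter> literal_var ` C \<noteq> {}} \<le> k * (L - 1)"
proof -
  have "card {C\<in>\<Gamma>. literal_var ` D \<inter> literal_var ` C \<noteq> {}}
      \<le> card {C \<in> \<Psi> - {D}. literal_var ` D \<inter> literal_var ` C \<noteq> {}}"
    using assms finite_\<Psi> by (intro card_mono) auto
  then show ?thesis
    using card_neighbours_le[OF finite_\<Psi> _ assms(1) occurrences] clause[OF assms(1)] by auto
qed

text \<open>The core induction of the local lemma: given that \<open>\<Gamma>\<close> holds,
  \<open>D\<close> is false with probability at most \<open>1 - q\<close>. Without the neighbours of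
  \<open>D\<close> the probability is \<open>1 / 2 ^ k\<close> by independence; restoring them costs
  a factor of at most \<open>1 / q\<close> each.\<close>

lemma number_falsifying_le:
  assumes "\<Gamma> \<subseteq> \<Psi>" "D \<in> \<Psi>" "D \<notin> \<Gamma>"
  shows "number \<Gamma> D \<le> (1 - q) * number \<Gamma> {}"
proof -
  have "finite \<Gamma>"
    using assms(1) finite_\<Psi> by (rule finite_subset)
  then show ?thesis
    using assms
  proof (induction \<Gamma> arbitrary: D rule: finite_psubset_induct)
    case (psubset \<Gamma>)
    define \<Delta> where "\<Delta> = {C\<in>\<Gamma>. literal_var ` D \<inter> literal_var ` C \<noteq> {}}"
    define \<Gamma>\<^sub>0 where "\<Gamma>\<^sub>0 = \<Gamma> - \<Delta>"
    have \<Gamma>: "\<Gamma>\<^sub>0 \<union> \<Delta> = \<Gamma>" "\<Gamma>\<^sub>0 \<subseteq> \<Gamma>" "\<Delta> \<subseteq> \<Gamma>" "\<Delta> \<inter> \<Gamma>\<^sub>0 = {}"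
      by (auto simp: \<Gamma>\<^sub>0_def \<Delta>_def)
    have card_\<Delta>: "card \<Delta> \<le> k * (L - 1)"
      unfolding \<Delta>_def using psubset.prems by (intro card_neighbours) auto
    have "q ^ card \<Delta> * number \<Gamma>\<^sub>0 {} \<le> number (\<Gamma>\<^sub>0 \<union> \<Delta>) {}"
    proof (rule number_extend_step)
      show "finite \<Delta>" using \<Gamma> psubset.hyps finite_subset by blast
      show "number \<Gamma>' D' \<le> (1 - q) * number \<Gamma>' {}"
        if "\<Gamma>' \<subset> \<Gamma>\<^sub>0 \<union> \<Delta>" "D' \<notin> \<Gamma>'" "D' \<in> \<Gamma>\<^sub>0 \<union> \<Delta>" for \<Gamma>' D'
        using that psubset.prems unfolding \<Gamma> by (intro psubset.IH) auto
    qed (use \<Gamma> in auto)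
    then have step: "q ^ card \<Delta> * number \<Gamma>\<^sub>0 {} \<le> number \<Gamma> {}"
      by (simp add: \<Gamma>)
    have "2 ^ k * number \<Gamma>\<^sub>0 D = number \<Gamma>\<^sub>0 {}"
      using number_independent[of D \<Gamma>\<^sub>0] clause[OF psubset.prems(2)]
      by (auto simp: \<Gamma>\<^sub>0_def \<Delta>_def)
    \<comment> \<open>The numerator only grows when \<open>\<Delta>\<close> is dropped;
      \<open>step\<close> controls the denominator at the end of the chain.\<close>
    have "number \<Gamma> D \<le> number \<Gamma>\<^sub>0 D * 1"
      using number_mono[OF \<Gamma>(2)] by simp
    also have "\<dots> \<le> number \<Gamma>\<^sub>0 D * (2 ^ k * (1 - q) * q ^ (k * (L - 1)))"
      using q(3) by (intro mult_left_mono) auto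
    also have "\<dots> = (1 - q) * (q ^ (k * (L - 1)) * number \<Gamma>\<^sub>0 {})"
      unfolding \<open>2 ^ k * number \<Gamma>\<^sub>0 D = number \<Gamma>\<^sub>0 {}\<close>[symmetric] by simp
    also have "\<dots> \<le> (1 - q) * (q ^ card \<Delta> * number \<Gamma>\<^sub>0 {})"
      using q card_\<Delta> by (intro mult_left_mono mult_right_mono power_decreasing) auto
    also have "\<dots> \<le> (1 - q) * number \<Gamma> {}"
      using q step by (intro mult_left_mono) auto
    finally show ?case .
  qed
qed

lemma number_extend:
  assumes "\<Delta> \<inter> \<Gamma> = {}" "\<Gamma> \<union> \<Delta> \<subseteq> \<Psi>"
  shows "q ^ card \<Delta> * number \<Gamma> {} \<le> number (\<Gamma> \<union> \<Delta>) {}"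
  using assms finite_subset[OF _ finite_\<Psi>]
  by (intro number_extend_step number_falsifying_le) auto

text \<open>The usual conclusion of the local lemma, obtained by adding all of
  \<open>\<Gamma>\<close> to the empty formula; it permits conditioning on
  \<open>\<Gamma>\<close>.\<close>

lemma number_pos:
  assumes "\<Gamma> \<subseteq> \<Psi>"
  shows "0 < number \<Gamma> {}"
proof -
  have "(\<lambda>x. False) \<in> models V {} {}"
    by (simp add: models_def sat_cnf_def sat_clause_def)
  then have "0 < number {} {}"
    using finite_models[OF finite_V] by (auto simp: card_gt_0_iff)
  then have "0 < q ^ card \<Gamma> * number {} {}"
    using q by simp
  also have "\<dots> \<le> number \<Gamma> {}"
    using number_extend[of \<Gamma> "{}"] assms by simp
  finally show ?thesis .
qed

end

section \<open>Short clauses are not implied\<close>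

lemma mult_pow2_le:
  fixes s t :: nat
  assumes "1 \<le> t" "t \<le> s"
  shows "s * 2 ^ t \<le> t * 2 ^ s"
  using assms(2,1)
proof (induction s rule: dec_induct)
  case (step n)
  \<comment> \<open>As \<open>n \<ge> 1\<close>, passing from \<open>n\<close> to
    \<open>n + 1\<close> at most doubles the left side, while the right side doubles
    exactly.\<close>
  have "Suc n * 2 ^ t \<le> 2 * (n * 2 ^ t)"
    using step by simp
  also have "\<dots> \<le> t * 2 ^ Suc n"
    using step by simp
  finally show ?case .
qed auto

text \<open>Both sides of the exchanged sum count the pairs of a clause \<open>D\<close> and a
  literal of \<open>C\<close> lying in \<open>D\<close>.\<close>

lemma sum_card_Int_le:
  assumes "finite \<Psi>" "finite C" "\<forall>l\<in>C. card {D\<in>\<Psi>. l \<in> D} \<le> L"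
  shows "(\<Sum>D\<in>\<Psi>. card (C \<inter> D)) \<le> card C * L"
proof -
  have "(\<Sum>D\<in>\<Psi>. card (C \<inter> D)) = (\<Sum>D\<in>\<Psi>. \<Sum>l\<in>C. if l \<in> D then 1 else 0)"
    using assms by (simp add: sum.If_cases Int_def)
  also have "\<dots> = (\<Sum>l\<in>C. \<Sum>D\<in>\<Psi>. if l \<in> D then 1 else 0)"
    by (rule sum.swap)
  also have "\<dots> = (\<Sum>l\<in>C. card {D\<in>\<Psi>. l \<in> D})"
    using assms by (simp add: sum.If_cases Int_def)
  also have "\<dots> \<le> card C * L"
    using sum_bounded_above[of C "\<lambda>l. card {D\<in>\<Psi>. l \<in> D}" L] assms(3) by simp
  finally show ?thesis .
qed

lemma sum_pow2_Int_le:
  assumes "finite \<Psi>" "finite C" "\<forall>l\<in>C. card {D\<in>\<Psi>. l \<in> D} \<le> L"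
  shows "(\<Sum>D | D \<in> \<Psi> \<and> C \<inter> D \<noteq> {}. 2 ^ card (C \<inter> D)) \<le> L * 2 ^ card C"
    (is "sum ?f ?T \<le> _")
\<comment> \<open>The main case cancels a factor \<open>card C\<close>; for empty \<open>C\<close>
  the sum has no terms.\<close>
proof (cases "C = {}")
  case False
  then have C: "0 < card C"
    using assms by (simp add: card_gt_0_iff)
  have "card C * (\<Sum>D\<in>?T. 2 ^ card (C \<inter> D)) = (\<Sum>D\<in>?T. card C * 2 ^ card (C \<inter> D))"
    by (rule sum_distrib_left)
  also have "\<dots> \<le> (\<Sum>D\<in>?T. card (C \<inter> D) * 2 ^ card C)"
  proof (intro sum_mono mult_pow2_le)
    fix D assume "D \<in> ?T"
    then show "1 \<le> card (C \<inter> D)"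
      using assms(2) by (simp add: Suc_le_eq card_gt_0_iff)
    show "card (C \<inter> D) \<le> card C"
      using assms(2) by (intro card_mono) auto
  qed
  also have "\<dots> \<le> (\<Sum>D\<in>\<Psi>. card (C \<inter> D) * 2 ^ card C)"
    using assms(1) by (intro sum_mono2) auto
  also have "\<dots> = (\<Sum>D\<in>\<Psi>. card (C \<inter> D)) * 2 ^ card C"
    by (rule sum_distrib_right[symmetric])
  also have "\<dots> \<le> card C * L * 2 ^ card C"
    using sum_card_Int_le[OF assms] by simp
  finally show ?thesis
    using C by (simp add: mult.assoc)
qed simp

text \<open>A union bound over \<open>T\<close> inside \<open>models V \<Gamma> C\<close>: by
  \<open>bound\<close> and the double counting, \<open>small\<close> says that the conditional
  probabilities of falsifying the clauses in \<open>T\<close> sum to less than 1.\<close>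

lemma (in local_lemma) exists_falsifying_model:
  assumes C: "finite C" "\<not> tautology C" "literal_var ` C \<subseteq> V"
    and small: "real L * 2 ^ card C < 2 ^ k * q ^ (k * (L - 1))"
  shows "\<exists>\<sigma>. sat_cnf \<sigma> \<Psi> \<and> \<not> sat_clause \<sigma> C"
proof -
  let ?d = "k * (L - 1)"
  define \<Gamma> where "\<Gamma> = {D\<in>\<Psi>. literal_var ` C \<inter> literal_var ` D = {}}"
  define T where "T = {D\<in>\<Psi>. C \<inter> D \<noteq> {}}"
  have \<Gamma>_\<Psi>: "\<Gamma> \<subseteq> \<Psi>" and T: "finite T"
    using finite_\<Psi> by (auto simp: \<Gamma>_def T_def)
  have C_\<Gamma>: "2 ^ card C * number \<Gamma> C = number \<Gamma> {}"
    using C by (intro number_independent) (auto simp: \<Gamma>_def)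
  have C_pos: "0 < number \<Gamma> C"
    using number_pos[OF \<Gamma>_\<Psi>] unfolding C_\<Gamma>[symmetric] by (simp add: zero_less_mult_iff)
  have bound: "2 ^ k * q ^ ?d * number \<Gamma> (C \<union> D) \<le> 2 ^ card (C \<inter> D) * number \<Gamma> C"
    if D: "D \<in> T" for D
  proof (cases "tautology (C \<union> D)")
    case True
    then have "models V \<Gamma> (C \<union> D) = {}"
      by (auto simp: models_def tautology_def)
    then show ?thesis by simp
  next
    case False
    have D': "D \<in> \<Psi>" "D \<notin> \<Gamma>"
      using D by (auto simp: T_def \<Gamma>_def)
    \<comment> \<open>Clauses of \<open>\<Gamma>\<close> avoid the variables of \<open>C\<close>;
      those outside \<open>\<Delta>\<close> also avoid the variables of \<open>D\<close>, so they
      are independent of \<open>C \<union> D\<close>.\<close>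
    define \<Delta> where "\<Delta> = {E\<in>\<Gamma>. literal_var ` D \<inter> literal_var ` E \<noteq> {}}"
    have \<Gamma>: "(\<Gamma> - \<Delta>) \<union> \<Delta> = \<Gamma>" by (auto simp: \<Delta>_def)
    have card: "k + card C = card (C \<inter> D) + card (C \<union> D)"
      using card_Un_Int[of C D] C clause[OF D'(1)] by simp
    have ind: "2 ^ card (C \<union> D) * number (\<Gamma> - \<Delta>) (C \<union> D) = number (\<Gamma> - \<Delta>) {}"
      using C clause[OF D'(1)] False
      by (intro number_independent) (auto simp: \<Gamma>_def \<Delta>_def)
    \<comment> \<open>The factor \<open>2 ^ card C\<close> allows \<open>C_\<Gamma>\<close> to
      replace \<open>number \<Gamma> C\<close> by \<open>number \<Gamma> {}\<close>.\<close>
    have "2 ^ card C * (2 ^ k * q ^ ?d * number \<Gamma> (C \<union> D))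
        = q ^ ?d * 2 ^ (k + card C) * number \<Gamma> (C \<union> D)"
      by (simp add: power_add)
    also have "\<dots> \<le> q ^ ?d * 2 ^ (k + card C) * number (\<Gamma> - \<Delta>) (C \<union> D)"
      using q by (intro mult_left_mono number_mono) auto
    also have "\<dots> = 2 ^ card (C \<inter> D) * (q ^ ?d * number (\<Gamma> - \<Delta>) {})"
      unfolding card ind[symmetric] by (simp add: power_add)
    also have "\<dots> \<le> 2 ^ card (C \<inter> D) * (q ^ card \<Delta> * number (\<Gamma> - \<Delta>) {})"
      using q card_neighbours[OF D'(1) \<Gamma>_\<Psi> D'(2)]
      by (intro mult_left_mono mult_right_mono power_decreasing) (auto simp: \<Delta>_def)
    also have "\<dots> \<le> 2 ^ card (C \<inter> D) * number \<Gamma> {}"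
      using number_extend[of \<Delta> "\<Gamma> - \<Delta>"] \<Gamma> \<Gamma>_\<Psi> by (intro mult_left_mono) auto
    also have "\<dots> = 2 ^ card C * (2 ^ card (C \<inter> D) * number \<Gamma> C)"
      unfolding C_\<Gamma>[symmetric] by simp
    finally show ?thesis by simp
  qed
  have "card {D\<in>\<Psi>. l \<in> D} \<le> L" for l
  proof -
    have "card {D\<in>\<Psi>. l \<in> D} \<le> card {D\<in>\<Psi>. occurs_in (literal_var l) D}"
      using finite_\<Psi> by (intro card_mono) (auto simp: occurs_in_iff)
    then show ?thesis
      using occurrences le_trans by blast
  qed
  then have "(\<Sum>D\<in>T. 2 ^ card (C \<inter> D)) \<le> L * 2 ^ card C"
    unfolding T_def using C finite_\<Psi> by (intro sum_pow2_Int_le) auto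
  then have "real (\<Sum>D\<in>T. 2 ^ card (C \<inter> D)) \<le> real (L * 2 ^ card C)"
    by (rule of_nat_mono)
  then have sum: "(\<Sum>D\<in>T. 2 ^ card (C \<inter> D) :: real) \<le> real L * 2 ^ card C"
    by simp
  have "2 ^ k * q ^ ?d * (\<Sum>D\<in>T. number \<Gamma> (C \<union> D))
      \<le> (\<Sum>D\<in>T. 2 ^ card (C \<inter> D)) * number \<Gamma> C"
    unfolding sum_distrib_left sum_distrib_right by (intro sum_mono bound)
  also have "\<dots> \<le> real L * 2 ^ card C * number \<Gamma> C"
    using sum by (intro mult_right_mono) auto
  also have "\<dots> < 2 ^ k * q ^ ?d * number \<Gamma> C"
    using small C_pos by (intro mult_strict_right_mono)
  finally have "(\<Sum>D\<in>T. number \<Gamma> (C \<union> D)) < number \<Gamma> C"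
    using q by (simp add: mult_less_cancel_left_pos)
  then have "real (\<Sum>D\<in>T. card (models V \<Gamma> (C \<union> D))) < number \<Gamma> C"
    by simp
  then have less: "(\<Sum>D\<in>T. card (models V \<Gamma> (C \<union> D))) < card (models V \<Gamma> C)"
    by (simp only: of_nat_less_iff)
  have "\<not> models V \<Gamma> C \<subseteq> (\<Union>D\<in>T. models V \<Gamma> (C \<union> D))"
  proof
    assume "models V \<Gamma> C \<subseteq> (\<Union>D\<in>T. models V \<Gamma> (C \<union> D))"
    then have "card (models V \<Gamma> C) \<le> card (\<Union>D\<in>T. models V \<Gamma> (C \<union> D))"
      using T finite_models[OF finite_V] by (intro card_mono) auto
    also have "\<dots> \<le> (\<Sum>D\<in>T. card (models V \<Gamma> (C \<union> D)))"
      using T by (rule card_UN_le)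
    finally show False using less by simp
  qed
  then obtain \<sigma> where \<sigma>: "\<sigma> \<in> models V \<Gamma> C" "\<forall>D\<in>T. \<sigma> \<notin> models V \<Gamma> (C \<union> D)"
    by auto
  \<comment> \<open>A false \<open>D\<close> would lie neither in \<open>\<Gamma>\<close> nor in
    \<open>T\<close>. It would thus share a variable but no literal with \<open>C\<close>, and so
    contain the complement of a literal falsified by \<open>\<sigma>\<close>.\<close>
  have "sat_clause \<sigma> D" if D: "D \<in> \<Psi>" for D
  proof (rule ccontr)
    assume D_false: "\<not> sat_clause \<sigma> D"
    with \<sigma> D have "C \<inter> D = {}"
      by (auto simp: models_def T_def sat_clause_Un)
    moreover have "D \<notin> \<Gamma>"
      using \<sigma> D_false by (auto simp: models_def sat_cnf_def)
    then obtain l m where lm: "l \<in> C" "m \<in> D" "literal_var l = literal_var m"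
      using D by (auto simp: \<Gamma>_def)
    ultimately have "l \<noteq> m" by auto
    moreover have "\<not> sat_literal \<sigma> l" "\<not> sat_literal \<sigma> m"
      using \<sigma>(1) D_false lm by (auto simp: models_def sat_clause_def)
    ultimately show False
      using lm by (cases l; cases m) auto
  qed
  then show ?thesis
    using \<sigma> by (auto simp: sat_cnf_def models_def)
qed

section \<open>Numerical estimate, reduction to uniform clauses and choice of
  \<open>q\<close>\<close>

lemma inverse_exp_le_power:
  fixes m d :: nat
  assumes "2 \<le> m" "d \<le> m - 1"
  shows "1 / exp 1 \<le> (1 - 1 / real m) ^ d"
proof -
  define n where "n = m - 1"
  have n: "real m = real n + 1" "0 < n" "d \<le> n"
    using assms by (auto simp: n_def of_nat_diff)
  \<comment> \<open>This reduces the claim to \<open>(1 + 1 / n) ^ n \<le> e\<close>.\<close>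
  have eq: "1 - 1 / real m = 1 / (1 + 1 / real n)"
    using n by (simp add: field_simps)
  have "(1 + 1 / real n) ^ n \<le> exp (1 / real n) ^ n"
    by (intro power_mono exp_ge_add_one_self) auto
  also have "\<dots> = exp 1"
    using n by (simp add: exp_of_nat_mult[symmetric])
  finally have "1 / exp 1 \<le> 1 / (1 + 1 / real n) ^ n"
    using n by (intro divide_left_mono) (auto intro!: mult_pos_pos zero_less_power add_pos_pos)
  also have "\<dots> = (1 - 1 / real m) ^ n"
    unfolding eq by (simp add: power_one_over)
  also have "\<dots> \<le> (1 - 1 / real m) ^ d"
    using n assms by (intro power_decreasing) auto
  finally show ?thesis .
qed

lemma exists_uniform_subformula:
  assumes \<Phi>: "is_cnf \<Phi>" "\<forall>C\<in>\<Phi>. clause_size C \<ge> k"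
    and occ: "\<forall>x. card {C\<in>\<Phi>. occurs_in x C} \<le> L"
  obtains \<Psi> where "finite \<Psi>" "\<And>D. D \<in> \<Psi> \<Longrightarrow> finite D \<and> card D = k \<and> \<not> tautology D"
    "\<forall>x. card {C\<in>\<Psi>. occurs_in x C} \<le> L" "\<And>\<sigma>. sat_cnf \<sigma> \<Psi> \<Longrightarrow> sat_cnf \<sigma> \<Phi>"
proof -
  have fin: "finite \<Phi>" "\<And>D. D \<in> \<Phi> \<Longrightarrow> finite D"
    using \<Phi> by (auto simp: is_cnf_def is_clause_def)
  have "\<forall>D\<in>\<Phi>. \<exists>D'. D' \<subseteq> D \<and> card D' = k"
    using \<Phi>(2) by (metis clause_size_def obtain_subset_with_card_n)
  then obtain shrink where shrink: "\<And>D. D \<in> \<Phi> \<Longrightarrow> shrink D \<subseteq> D \<and> card (shrink D) = k"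
    by metis
  define \<Psi> where "\<Psi> = shrink ` {D\<in>\<Phi>. \<not> tautology D}"
  show ?thesis
  proof (rule that)
    show "finite \<Psi>"
      using fin by (simp add: \<Psi>_def)
    show "finite D \<and> card D = k \<and> \<not> tautology D" if D: "D \<in> \<Psi>" for D
    proof -
      obtain D' where "D' \<in> \<Phi>" "\<not> tautology D'" "D = shrink D'"
        using D by (auto simp: \<Psi>_def)
      then show ?thesis
        using shrink[of D'] fin(2)[of D'] tautology_mono[of D D'] finite_subset[of D D'] by auto
    qed
    show "\<forall>x. card {C\<in>\<Psi>. occurs_in x C} \<le> L"
    proof
      fix x
      \<comment> \<open>Shrinking may merge clauses, but every clause of \<open>\<Psi>\<close>
        containing \<open>x\<close> comes from one of \<open>\<Phi>\<close> containing
        \<open>x\<close>.\<close>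
      have "{C\<in>\<Psi>. occurs_in x C} \<subseteq> shrink ` {C\<in>\<Phi>. occurs_in x C}"
        using shrink unfolding \<Psi>_def occurs_in_def by blast
      then have "card {C\<in>\<Psi>. occurs_in x C} \<le> card {C\<in>\<Phi>. occurs_in x C}"
        using fin by (intro surj_card_le) auto
      then show "card {C\<in>\<Psi>. occurs_in x C} \<le> L"
        using occ le_trans by blast
    qed
    show "sat_cnf \<sigma> \<Phi>" if \<sigma>: "sat_cnf \<sigma> \<Psi>" for \<sigma>
      unfolding sat_cnf_def
    proof
      fix D assume D: "D \<in> \<Phi>"
      show "sat_clause \<sigma> D"
      proof (cases "tautology D")
        case False
        then have "sat_clause \<sigma> (shrink D)"
          using \<sigma> D by (simp add: \<Psi>_def sat_cnf_def)
        then show ?thesis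
          using shrink[OF D] by (auto simp: sat_clause_def)
      qed (simp add: tautology_def)
    qed
  qed
qed

lemma exists_model_falsifying_short_clause:
  fixes k L :: nat
  assumes "k \<ge> 1" "L \<ge> 1" and kL: "exp 1 * (real k * real L) \<le> 2 ^ k"
    and \<Phi>: "is_cnf \<Phi>" "\<forall>C\<in>\<Phi>. clause_size C \<ge> k" "\<forall>x. card {C\<in>\<Phi>. occurs_in x C} \<le> L"
    and C: "finite C" "\<not> tautology C" "exp 1 * real L * 2 ^ card C < 2 ^ k"
  shows "\<exists>\<sigma>. sat_cnf \<sigma> \<Phi> \<and> \<not> sat_clause \<sigma> C"
proof -
  obtain \<Psi> where \<Psi>: "finite \<Psi>" "\<And>D. D \<in> \<Psi> \<Longrightarrow> finite D \<and> card D = k \<and> \<not> tautology D"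
    "\<forall>x. card {C\<in>\<Psi>. occurs_in x C} \<le> L" "\<And>\<sigma>. sat_cnf \<sigma> \<Psi> \<Longrightarrow> sat_cnf \<sigma> \<Phi>"
    using exists_uniform_subformula[OF \<Phi>] by metis
  \<comment> \<open>\<open>k * L = 1\<close> would give \<open>q = 0\<close> below; it is excluded
    because \<open>e \<ge> (1 + 1/2)^2 = 9/4 > 2\<close>.\<close>
  have "k * L \<noteq> 1"
  proof
    assume "k * L = 1"
    then have "exp 1 \<le> (2 :: real)"
      using kL by simp
    then show False
      using exp_ge_one_plus_x_over_n_power_n[of 2 1] by (simp add: power2_eq_square)
  qed
  moreover have "k * L \<noteq> 0"
    using assms by simp
  ultimately have m: "2 \<le> k * L" by linarith
  \<comment> \<open>With this choice \<open>1 - q = 1 / (k * L)\<close>, and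
    \<open>q ^ (k * (L - 1)) \<ge> 1 / e\<close> since \<open>k * (L - 1) \<le> k * L - 1\<close>.
    Hence \<open>kL\<close> yields the condition of the local lemma.\<close>
  define q where "q = 1 - 1 / real (k * L)"
  have q01: "0 < q" "q < 1"
    using m assms(1,2) unfolding q_def by (simp_all add: divide_less_eq del: of_nat_mult)
  have "k * (L - 1) \<le> k * L - 1"
    using assms by (simp add: right_diff_distrib')
  then have qe: "1 / exp 1 \<le> q ^ (k * (L - 1))"
    unfolding q_def using m by (intro inverse_exp_le_power)
  then have qe': "2 ^ k \<le> exp 1 * (2 ^ k * q ^ (k * (L - 1)))"
    by (simp add: field_simps)
  define V where "V = literal_var ` (C \<union> \<Union>\<Psi>)"
  interpret local_lemma V \<Psi> k L q
  proof
    show "finite V"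
      using C \<Psi> by (auto simp: V_def)
    have "real k * real L * 1 \<le> real k * real L * (2 ^ k * (1 - q) * q ^ (k * (L - 1)))"
    proof -
      have "exp 1 * (real k * real L) \<le> exp 1 * (2 ^ k * q ^ (k * (L - 1)))"
        using kL qe' by linarith
      then have "real k * real L \<le> 2 ^ k * q ^ (k * (L - 1))"
        by simp
      also have "\<dots> = real k * real L * (2 ^ k * (1 - q) * q ^ (k * (L - 1)))"
        using assms(1,2) by (simp add: q_def)
      finally show ?thesis by simp
    qed
    then show "1 \<le> 2 ^ k * (1 - q) * q ^ (k * (L - 1))"
      using assms(1,2) by (subst (asm) mult_le_cancel_left_pos) auto
  qed (use \<Psi> q01 in \<open>auto simp: V_def\<close>)
  have "exp 1 * (real L * 2 ^ card C) < exp 1 * (2 ^ k * q ^ (k * (L - 1)))"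
    using C(3) qe' by linarith
  then have "real L * 2 ^ card C < 2 ^ k * q ^ (k * (L - 1))"
    by simp
  then have "\<exists>\<sigma>. sat_cnf \<sigma> \<Psi> \<and> \<not> sat_clause \<sigma> C"
    using C by (intro exists_falsifying_model) (auto simp: V_def)
  then show ?thesis
    using \<Psi>(4) by blast
qed

theorem proposition5p2:
  fixes k L :: nat and \<Phi> :: "'v cnf"
  assumes "k \<ge> 1" and "L \<ge> 1"
    and "real L \<le> 2 ^ k / (exp 1 * real k)"
    and "is_cnf \<Phi>"
    and "\<forall>C\<in>\<Phi>. clause_size C \<ge> k"
    and "\<forall>x. card {C\<in>\<Phi>. occurs_in x C} \<le> L"
  shows "(\<forall>C. nontrivial_implicate \<Phi> C \<longrightarrow>
            int (clause_size C) \<ge> int k - \<lfloor>log 2 (exp 1 * real L)\<rfloor>) \<and>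
         real_of_int (int k - \<lfloor>log 2 (exp 1 * real L)\<rfloor>) \<ge> log 2 (real k)"
proof
  have kL: "exp 1 * (real k * real L) \<le> 2 ^ k"
    using assms(1,3) by (simp add: field_simps)
  show "\<forall>C. nontrivial_implicate \<Phi> C \<longrightarrow>
      int (clause_size C) \<ge> int k - \<lfloor>log 2 (exp 1 * real L)\<rfloor>"
  proof (intro allI impI, rule ccontr)
    fix C assume C: "nontrivial_implicate \<Phi> C"
      and "\<not> int (clause_size C) \<ge> int k - \<lfloor>log 2 (exp 1 * real L)\<rfloor>"
    then have "\<lfloor>log 2 (exp 1 * real L)\<rfloor> < int k - int (card C)"
      by (simp add: clause_size_def)
    \<comment> \<open>A floor is below an integer exactly when the number itself is, so the rounding
      loses nothing here.\<close>
    then have "log 2 (exp 1 * real L) < real k - real (card C)"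
      by (simp add: floor_less_iff)
    then have "exp 1 * real L < 2 powr (real k - real (card C))"
      using assms(2) by (simp add: log_less_iff)
    also have "\<dots> = 2 ^ k / 2 ^ card C"
      by (simp add: powr_diff powr_realpow)
    finally have "exp 1 * real L * 2 ^ card C < 2 ^ k"
      by (simp add: field_simps)
    moreover have "finite C" "\<not> tautology C"
      using C by (auto simp: nontrivial_implicate_def is_clause_def)
    ultimately have "\<exists>\<sigma>. sat_cnf \<sigma> \<Phi> \<and> \<not> sat_clause \<sigma> C"
      using assms kL by (intro exists_model_falsifying_short_clause)
    then show False
      using C by (auto simp: nontrivial_implicate_def entails_def)
  qed
  \<comment> \<open>The second claim is the logarithm of \<open>kL\<close>; the floor only enlarges
    the difference.\<close>
  have "log 2 (exp 1 * real L) + log 2 (real k) = log 2 (exp 1 * (real k * real L))"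
    using assms(1,2) by (simp add: log_mult)
  also have "\<dots> \<le> log 2 (2 ^ k)"
    using assms(1,2) kL by (subst log_le_cancel_iff) auto
  also have "\<dots> = real k"
    by (simp add: log_nat_power)
  finally have "log 2 (real k) \<le> real k - log 2 (exp 1 * real L)"
    by (simp only: le_diff_eq add.commute)
  also have "\<dots> \<le> real k - \<lfloor>log 2 (exp 1 * real L)\<rfloor>"
    by (intro diff_left_mono of_int_floor_le)
  finally show "real_of_int (int k - \<lfloor>log 2 (exp 1 * real L)\<rfloor>) \<ge> log 2 (real k)"
    by simp
qed

end
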